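(* Let $m\ge 2$. Let $\mathcal{P}$ be an integral point set in the plane $\mathbb{E}^2$ consisting of $n$ points, where $n-1$ of the points lie on a line $\ell$ and the remaining point has distance $h>0$ from $\ell$. Let $\mathcal{P}'$ be an integral point set in $\mathbb{E}^{m-1}$ consisting of $n'$ points, all of which lie on a sphere of radius $h$ in $\mathbb{E}^{m-1}$. Then $$d(m,n+n'-1)\le \max(\operatorname{diam}(\mathcal{P}),\operatorname{diam}(\mathcal{P}')).$$
   Context: An integral point set in the $k$-dimensional Euclidean space $\mathbb{E}^k$ is a set of points in $\mathbb{E}^k$ whose pairwise Euclidean distances are all integers and which are not all contained in a common affine hyperplane of $\mathbb{E}^k$. Its diameter $\operatorname{diam}$ is the largest distance between two of its points. For integers $n\ge m+1$, $d(m,n)$ denotes the minimum possible diameter of an integral point set in $\mathbb{E}^m$ consisting of $n$ points. A sphere of radius $h$ in $\mathbb{E}^{m-1}$ is the set of points at distance $h$ from a fixed center (for $m=2$ it consists of two points). *)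

theory Defs
  imports "HOL-Analysis.Analysis"
begin

text \<open>
  The Euclidean space of dimension \<open>k\<close> is \<^term>\<open>topspace (Euclidean_space k)\<close>, i.e. the functions
  \<^typ>\<open>nat \<Rightarrow> real\<close> that vanish at all indices \<open>\<ge> k\<close>, so that spaces of different dimensions can
  occur in one statement. The type class metric on \<^typ>\<open>nat \<Rightarrow> real\<close> is not the Euclidean one,
  so the metric notions are introduced here.
\<close>

definition edist :: "nat \<Rightarrow> (nat \<Rightarrow> real) \<Rightarrow> (nat \<Rightarrow> real) \<Rightarrow> real" where
  "edist k x y = L2_set (\<lambda>i. x i - y i) {..<k}"

definition affine_hyperplane :: "nat \<Rightarrow> (nat \<Rightarrow> real) set \<Rightarrow> bool" where
  "affine_hyperplane k H \<longleftrightarrow>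
     (\<exists>a b. (\<exists>i<k. a i \<noteq> 0) \<and> H = {x \<in> topspace (Euclidean_space k). (\<Sum>i<k. a i * x i) = b})"

definition affine_line :: "nat \<Rightarrow> (nat \<Rightarrow> real) set \<Rightarrow> bool" where
  "affine_line k L \<longleftrightarrow>
     (\<exists>p\<in>topspace (Euclidean_space k). \<exists>v\<in>topspace (Euclidean_space k).
        v \<noteq> (\<lambda>i. 0) \<and> L = range (\<lambda>t i. p i + t * v i))"

definition dist_to_set :: "nat \<Rightarrow> (nat \<Rightarrow> real) \<Rightarrow> (nat \<Rightarrow> real) set \<Rightarrow> real" where
  "dist_to_set k q A = (INF x\<in>A. edist k q x)"

definition esphere :: "nat \<Rightarrow> (nat \<Rightarrow> real) \<Rightarrow> real \<Rightarrow> (nat \<Rightarrow> real) set" where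
  "esphere k c r = {x \<in> topspace (Euclidean_space k). edist k c x = r}"

definition integral_point_set :: "nat \<Rightarrow> (nat \<Rightarrow> real) set \<Rightarrow> bool" where
  "integral_point_set k P \<longleftrightarrow>
     P \<subseteq> topspace (Euclidean_space k) \<and>
     (\<forall>x\<in>P. \<forall>y\<in>P. edist k x y \<in> \<int>) \<and>
     \<not> (\<exists>H. affine_hyperplane k H \<and> P \<subseteq> H)"

text \<open>Intended for finite nonempty \<open>P\<close> only.\<close>

definition ediam :: "nat \<Rightarrow> (nat \<Rightarrow> real) set \<Rightarrow> real" where
  "ediam k P = Max {edist k x y | x y. x \<in> P \<and> y \<in> P}"

definition min_diam :: "nat \<Rightarrow> nat \<Rightarrow> real" where
  "min_diam m n =
     (LEAST r. \<exists>P. integral_point_set m P \<and> finite P \<and> card P = n \<and> ediam m P = r)"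

text \<open>
  A least real number need not exist in general, but diameters of finite integral point sets are
  natural numbers, so the minimum is attained as soon as one such set exists.
\<close>

lemma ediam_nat:
  assumes "integral_point_set k P" "finite P" "P \<noteq> {}"
  obtains j :: nat where "ediam k P = real j"
proof -
  let ?D = "{edist k x y | x y. x \<in> P \<and> y \<in> P}"
  have "?D = (\<lambda>(x, y). edist k x y) ` (P \<times> P)" by auto
  then have "finite ?D" using assms(2) by simp
  moreover have "?D \<noteq> {}" using assms(3) by auto
  ultimately have "ediam k P \<in> ?D" unfolding ediam_def by (rule Max_in)
  then obtain x y where "x \<in> P" "y \<in> P" "ediam k P = edist k x y" by auto
  moreover have "edist k x y \<ge> 0" by (simp add: edist_def)
  ultimately have "ediam k P \<in> \<nat>"
    using assms(1) by (simp add: integral_point_set_def Nats_altdef2)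
  then show thesis using that by (auto elim: Nats_cases)
qed

lemma min_diam_attained:
  assumes "integral_point_set m Q" "finite Q" "card Q = n" "n > 0"
  shows "\<exists>P. integral_point_set m P \<and> finite P \<and> card P = n \<and> ediam m P = min_diam m n"
    and "min_diam m n \<le> ediam m Q"
proof -
  define S where
    "S r \<longleftrightarrow> (\<exists>P. integral_point_set m P \<and> finite P \<and> card P = n \<and> ediam m P = r)" for r
  have nat: "\<exists>j::nat. r = real j" if "S r" for r
    using that assms(4) unfolding S_def by (metis ediam_nat card.empty less_irrefl)
  have SQ: "S (ediam m Q)" using assms S_def by blast
  define j where "j = (LEAST j::nat. S (real j))"
  have "\<exists>j::nat. S (real j)" using nat[OF SQ] SQ by auto
  then have Sj: "S (real j)" unfolding j_def by (rule LeastI_ex)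
  have le: "real j \<le> r" if "S r" for r
    using nat[OF that] that unfolding j_def by (auto intro: Least_le)
  have "min_diam m n = real j"
    unfolding min_diam_def S_def[symmetric] using Sj le by (intro Least_equality)
  then show "\<exists>P. integral_point_set m P \<and> finite P \<and> card P = n \<and> ediam m P = min_diam m n"
    and "min_diam m n \<le> ediam m Q"
    using Sj le[OF SQ] by (auto simp: S_def)
qed

end

theory Submission
  imports Defs
begin

text \<open>
  Keep \<open>P'\<close> in the hyperplane \<open>x\<^sub>m = 0\<close> of the \<open>m\<close>-dimensional space and erect at the
  centre \<open>c\<close> of its sphere the line orthogonal to this hyperplane. Place the points of \<open>P\<close> on \<open>L\<close>
  isometrically on that line so that the foot of the perpendicular from \<open>q\<close> goes to \<open>c\<close>. By
  Pythagoras every point of \<open>P'\<close> then has the same distances to these points as \<open>q\<close> has, so only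
  distances from \<open>P\<close> and from \<open>P'\<close> occur.
\<close>

lemma edist_nonneg: "0 \<le> edist k x y"
  by (simp add: edist_def)

lemma edist_self [simp]: "edist k x x = 0"
  by (simp add: edist_def L2_set_def)

lemma edist_commute: "edist k x y = edist k y x"
  by (simp add: edist_def L2_set_def power2_commute)

lemma edist_power2: "(edist k x y)\<^sup>2 = (\<Sum>i<k. (x i - y i)\<^sup>2)"
  by (simp add: edist_def L2_set_def sum_nonneg)

lemma edist_eqI:
  assumes "(edist k x y)\<^sup>2 = r\<^sup>2" "0 \<le> r"
  shows "edist k x y = r"
  using assms edist_nonneg by (simp add: power2_eq_iff_nonneg)

text \<open>Index \<open>k\<close> carries the height above the hyperplane; this splitting is the
  form in which Pythagoras enters the placement below.\<close>

lemma edist_Suc_power2: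
  "(edist (Suc k) x y)\<^sup>2 = (edist k x y)\<^sup>2 + (x k - y k)\<^sup>2"
  by (simp add: edist_power2)

text \<open>\<open>edist k\<close> reads only indices below \<open>k\<close>, so raising a point in
  coordinate \<open>k\<close> leaves its horizontal distances alone.\<close>

lemma edist_fun_upd [simp]:
  "edist k (x(k := s)) y = edist k x y" "edist k x (y(k := s)) = edist k x y"
  by (simp_all add: edist_def L2_set_def)

lemma mem_Euclidean_space:
  "x \<in> topspace (Euclidean_space k) \<longleftrightarrow> (\<forall>i\<ge>k. x i = 0)"
  by (simp add: topspace_Euclidean_space)

lemma edist_eq_0_iff:
  assumes "x \<in> topspace (Euclidean_space k)" "y \<in> topspace (Euclidean_space k)"
  shows "edist k x y = 0 \<longleftrightarrow> x = y"
proof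
  assume "edist k x y = 0"
  then have "x i = y i" if "i < k" for i
    using that by (simp add: edist_def L2_set_eq_0_iff)
  moreover have "x i = y i" if "\<not> i < k" for i
    using that assms by (simp add: mem_Euclidean_space)
  ultimately show "x = y" by blast
qed simp

lemma edist_le_ediam:
  assumes "finite P" "x \<in> P" "y \<in> P"
  shows "edist k x y \<le> ediam k P"
proof -
  have "{edist k x y | x y. x \<in> P \<and> y \<in> P} = (\<lambda>(x, y). edist k x y) ` (P \<times> P)" by auto
  then have "finite {edist k x y | x y. x \<in> P \<and> y \<in> P}" using assms(1) by simp
  then show ?thesis unfolding ediam_def using assms by (intro Max_ge) auto
qed

lemma ediam_leI:
  assumes "finite P" "P \<noteq> {}" "\<And>x y. x \<in> P \<Longrightarrow> y \<in> P \<Longrightarrow> edist k x y \<le> r"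
  shows "ediam k P \<le> r"
proof -
  have eq: "{edist k x y | x y. x \<in> P \<and> y \<in> P} = (\<lambda>(x, y). edist k x y) ` (P \<times> P)" by auto
  show ?thesis unfolding ediam_def eq
    using assms by (intro Max.boundedI) auto
qed

lemma affine_line_subset_Euclidean_space:
  assumes "affine_line k L"
  shows "L \<subseteq> topspace (Euclidean_space k)"
  using assms by (auto simp: affine_line_def mem_Euclidean_space)

text \<open>The function \<open>s\<close> is a signed arc length along the line whose zero is the
  foot of the perpendicular from \<open>q\<close>. The second property is then Pythagoras.\<close>

lemma affine_line_coordinate:
  assumes "affine_line k L"
  obtains s :: "(nat \<Rightarrow> real) \<Rightarrow> real"
    where "\<And>x y. x \<in> L \<Longrightarrow> y \<in> L \<Longrightarrow> edist k x y = \<bar>s x - s y\<bar>"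
      and "\<And>x. x \<in> L \<Longrightarrow> (edist k q x)\<^sup>2 = (dist_to_set k q L)\<^sup>2 + (s x)\<^sup>2"
proof -
  obtain p v where v: "v \<in> topspace (Euclidean_space k)" "v \<noteq> (\<lambda>i. 0)"
    and L: "L = range (\<lambda>t i. p i + t * v i)"
    using assms unfolding affine_line_def by blast
  define N where "N = (\<Sum>i<k. (v i)\<^sup>2)"
  define B where "B = (\<Sum>i<k. (q i - p i) * v i)"
  define A where "A = (\<Sum>i<k. (q i - p i)\<^sup>2)"
  \<comment> \<open>The minimiser of the quadratic \<open>A - 2 * t * B + t\<^sup>2 * N\<close>, the
    squared distance from \<open>q\<close>; hence the parameter of the foot.\<close>
  define t0 where "t0 = B / N"
  define pt where "pt t = (\<lambda>i. p i + t * v i)" for t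
  \<comment> \<open>The component of \<open>x - q\<close> along the unit vector of \<open>v\<close>.
    Subtracting \<open>q\<close> rather than \<open>p\<close> puts the zero at the foot.\<close>
  define s where "s x = (\<Sum>i<k. (x i - q i) * v i) / sqrt N" for x
  have "\<exists>i<k. v i \<noteq> 0"
    using v unfolding mem_Euclidean_space fun_eq_iff by (metis not_le)
  then have N: "N > 0"
    unfolding N_def by (auto intro: sum_pos2)
  have s: "s (pt t) = (t - t0) * sqrt N" for t
  proof -
    have "(\<Sum>i<k. (pt t i - q i) * v i) = t * N - B"
      unfolding pt_def N_def B_def
      by (simp add: algebra_simps power2_eq_square sum.distrib sum_subtractf sum_distrib_left)
    also have "\<dots> = (t - t0) * sqrt N * sqrt N"
      using N by (simp add: t0_def field_simps)
    finally show ?thesis using N by (simp add: s_def)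
  qed
  have E: "(edist k q (pt t))\<^sup>2 = A - 2 * t * B + t\<^sup>2 * N" for t
    unfolding edist_power2 pt_def A_def B_def N_def
    by (simp add: algebra_simps power2_eq_square sum.distrib sum_subtractf sum_distrib_left)
  have B: "B = t0 * N" using N by (simp add: t0_def)
  \<comment> \<open>Completing the square: with \<open>B = t0 * N\<close> the quadratic is its value
    at \<open>t0\<close> plus \<open>(t - t0)\<^sup>2 * N\<close>.\<close>
  have foot: "(edist k q (pt t))\<^sup>2 = (edist k q (pt t0))\<^sup>2 + (s (pt t))\<^sup>2" for t
    using N unfolding E s B by (simp add: power_mult_distrib) (simp add: algebra_simps power2_eq_square)
  have "edist k q (pt t0) \<le> edist k q (pt t)" for t
    using foot[of t] by (intro power2_le_imp_le[OF _ edist_nonneg]) simp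
  then have h: "dist_to_set k q L = edist k q (pt t0)"
    unfolding dist_to_set_def L pt_def by (intro cInf_eq_minimum) auto
  have isom: "edist k (pt t) (pt u) = \<bar>s (pt t) - s (pt u)\<bar>" for t u
  proof (rule edist_eqI)
    have "(edist k (pt t) (pt u))\<^sup>2 = (t - u)\<^sup>2 * N"
      unfolding edist_power2 pt_def N_def
      by (simp add: sum_distrib_left power_mult_distrib mult.commute flip: left_diff_distrib)
    also have "\<dots> = ((t - u) * sqrt N)\<^sup>2"
      using N by (simp add: power_mult_distrib)
    also have "(t - u) * sqrt N = s (pt t) - s (pt u)"
      unfolding s by (simp add: algebra_simps)
    finally show "(edist k (pt t) (pt u))\<^sup>2 = \<bar>s (pt t) - s (pt u)\<bar>\<^sup>2" by simp
  qed simp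
  have pt: "\<exists>t. x = pt t" if "x \<in> L" for x
    using that by (auto simp: L pt_def)
  show thesis
  proof (rule that[of s])
    show "edist k x y = \<bar>s x - s y\<bar>" if "x \<in> L" "y \<in> L" for x y
      using isom pt[OF that(1)] pt[OF that(2)] by blast
    show "(edist k q x)\<^sup>2 = (dist_to_set k q L)\<^sup>2 + (s x)\<^sup>2" if "x \<in> L" for x
      unfolding h using foot pt[OF that] by blast
  qed
qed

text \<open>With at most one further point, \<open>P\<close> would lie on a line through
  \<open>q\<close>, which is a hyperplane of the plane. The two points later supply two different
  heights over \<open>c\<close>.\<close>

lemma integral_point_set_plane_two_others:
  assumes "integral_point_set 2 P" "q \<in> P"
  obtains x y where "x \<in> P - {q}" "y \<in> P - {q}" "x \<noteq> y"
proof (rule ccontr)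
  assume "\<not> thesis"
  with that have single: "x = y" if "x \<in> P - {q}" "y \<in> P - {q}" for x y
    using \<open>x \<in> P - {q}\<close> \<open>y \<in> P - {q}\<close> by blast
  have E: "P \<subseteq> topspace (Euclidean_space 2)"
    using assms(1) by (simp add: integral_point_set_def)
  obtain z where z: "z \<in> topspace (Euclidean_space 2)" "z \<noteq> q" "P \<subseteq> {q, z}"
  proof (cases "P - {q} = {}")
    case True
    \<comment> \<open>If \<open>P = {q}\<close>, any other point of the plane can span the
      line.\<close>
    define z where "z = q(0 := q 0 + 1)"
    have "z 0 \<noteq> q 0" by (simp add: z_def)
    moreover have "z \<in> topspace (Euclidean_space 2)"
      using E assms(2) by (auto simp: z_def mem_Euclidean_space)
    ultimately show ?thesis using True that[of z] by auto
  next
    case False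
    then obtain z where "z \<in> P - {q}" by blast
    then show ?thesis using that[of z] single E by blast
  qed
  \<comment> \<open>On the indices 0 and 1 this is \<open>z - q\<close> turned by a right angle,
    hence a normal of the line through \<open>q\<close> and \<open>z\<close>.\<close>
  define a where "a i = (if i = 0 then z 1 - q 1 else q 0 - z 0)" for i :: nat
  have "\<exists>i<2. z i \<noteq> q i"
  proof -
    have "\<forall>i\<ge>2. q i = 0"
      using E assms(2) by (auto simp: mem_Euclidean_space)
    then show ?thesis
      using z(1,2) unfolding mem_Euclidean_space fun_eq_iff by (metis not_le)
  qed
  then have "a 0 \<noteq> 0 \<or> a 1 \<noteq> 0"
    unfolding less_2_cases_iff by (auto simp: a_def)
  then have "\<exists>i<2. a i \<noteq> 0"
    by (metis one_less_numeral_iff semiring_norm(76) zero_less_numeral)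
  then have "affine_hyperplane 2 {x \<in> topspace (Euclidean_space 2).
      (\<Sum>i<2. a i * x i) = (\<Sum>i<2. a i * q i)}"
    unfolding affine_hyperplane_def by blast
  moreover have "P \<subseteq> {x \<in> topspace (Euclidean_space 2).
      (\<Sum>i<2. a i * x i) = (\<Sum>i<2. a i * q i)}"
  proof -
    have "(\<Sum>i<2. a i * z i) = (\<Sum>i<2. a i * q i)"
      by (simp add: a_def numeral_2_eq_2 algebra_simps)
    then show ?thesis using z(3) E by blast
  qed
  ultimately show False
    using assms(1) unfolding integral_point_set_def by blast
qed

text \<open>Two points that differ only in coordinate \<open>k\<close> force \<open>a k = 0\<close>
  in the equation of a hyperplane through \<open>Q\<close>. What remains is a hyperplane of the
  smaller space that contains \<open>P'\<close>.\<close>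

lemma not_in_hyperplane_Suc:
  assumes P': "\<not> (\<exists>H. affine_hyperplane k H \<and> P' \<subseteq> H)"
    and E: "P' \<subseteq> topspace (Euclidean_space k)"
    and "P' \<subseteq> Q" "c(k := s) \<in> Q" "c(k := t) \<in> Q" "s \<noteq> t"
  shows "\<not> (\<exists>H. affine_hyperplane (Suc k) H \<and> Q \<subseteq> H)"
proof
  assume "\<exists>H. affine_hyperplane (Suc k) H \<and> Q \<subseteq> H"
  then obtain a b where a: "\<exists>i<Suc k. a i \<noteq> 0"
    and Q: "\<And>x. x \<in> Q \<Longrightarrow> (\<Sum>i<Suc k. a i * x i) = b"
    unfolding affine_hyperplane_def by blast
  from Q[OF assms(4)] Q[OF assms(5)] have "(\<Sum>i<k. a i * c i) + a k * s = (\<Sum>i<k. a i * c i) + a k * t"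
    by (simp del: mult_cancel_left add_left_cancel)
  with \<open>s \<noteq> t\<close> have ak: "a k = 0" by simp
  with a have "\<exists>i<k. a i \<noteq> 0" by (auto simp: less_Suc_eq)
  then have "affine_hyperplane k {x \<in> topspace (Euclidean_space k). (\<Sum>i<k. a i * x i) = b}"
    unfolding affine_hyperplane_def by blast
  moreover have "(\<Sum>i<k. a i * x i) = b" if "x \<in> P'" for x
    using Q[of x] that assms(3) ak by auto
  ultimately show False
    using P' E by blast
qed

theorem theorem4:
  fixes m n n' :: nat
    and P P' L :: "(nat \<Rightarrow> real) set"
    and q c :: "nat \<Rightarrow> real"
    and h :: real
  assumes "m \<ge> 2"
    and "integral_point_set 2 P" and "finite P" and "card P = n"
    and "affine_line 2 L"
    and "q \<in> P" and "P - {q} \<subseteq> L"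
    and "dist_to_set 2 q L = h" and "h > 0"
    and "integral_point_set (m - 1) P'" and "finite P'" and "card P' = n'"
    and "c \<in> topspace (Euclidean_space (m - 1))"
    and "P' \<subseteq> esphere (m - 1) c h"
  shows "min_diam m (n + n' - 1) \<le> max (ediam 2 P) (ediam (m - 1) P')"
proof -
  define k where "k = m - 1"
  have m: "m = Suc k" using assms(1) by (simp add: k_def)
  note P' = assms(10,13,14)[folded k_def]
  let ?max = "max (ediam 2 P) (ediam k P')"
  obtain s where s: "\<And>x y. x \<in> L \<Longrightarrow> y \<in> L \<Longrightarrow> edist 2 x y = \<bar>s x - s y\<bar>"
    and pyth: "\<And>x. x \<in> L \<Longrightarrow> (edist 2 q x)\<^sup>2 = h\<^sup>2 + (s x)\<^sup>2"
    using affine_line_coordinate[OF assms(5), of q] assms(8) by metis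
  have LE: "L \<subseteq> topspace (Euclidean_space 2)"
    using assms(5) by (rule affine_line_subset_Euclidean_space)
  \<comment> \<open>Distance zero implies equality only inside the plane, since
    \<open>edist 2\<close> ignores the later coordinates; hence the use of
    \<open>LE\<close>.\<close>
  have inj_s: "inj_on s L"
    using s LE edist_eq_0_iff by (intro inj_onI) (metis abs_zero diff_self subsetD)
  define R where "R = P - {q}"
  have R: "R \<subseteq> L" "R \<subseteq> P" "finite R" "card R = n - 1"
    using assms(3,4,6,7) by (auto simp: R_def)
  \<comment> \<open>The point at signed height \<open>s x\<close> over the centre; the foot has
    \<open>s = 0\<close> and would go to \<open>c\<close> itself.\<close>
  define e where "e x = c(k := s x)" for x
  have P'E: "P' \<subseteq> topspace (Euclidean_space k)"
    using P'(1) by (simp add: integral_point_set_def)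
  have P'k: "x k = 0" if "x \<in> P'" for x
    using that P'E by (auto simp: mem_Euclidean_space)
  have rad: "edist k c x = h" if "x \<in> P'" for x
    using that P'(3) by (auto simp: esphere_def)

  \<comment> \<open>Distances after the placement\<close>
  have dRR: "edist m (e x) (e y) = edist 2 x y" if "x \<in> R" "y \<in> R" for x y
  proof (rule edist_eqI)
    show "(edist m (e x) (e y))\<^sup>2 = (edist 2 x y)\<^sup>2"
      using that R(1) by (simp add: m edist_Suc_power2 e_def s subset_iff)
  qed (rule edist_nonneg)
  have dPR: "edist m (e y) x = edist 2 q y" if "x \<in> P'" "y \<in> R" for x y
  proof (rule edist_eqI)
    show "(edist m (e y) x)\<^sup>2 = (edist 2 q y)\<^sup>2"
      \<comment> \<open>The horizontal part is the radius \<open>h\<close>, the vertical part is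
        \<open>s y\<close>, and \<open>pyth\<close> gives the same sum of squares for
        \<open>q\<close>.\<close>
      using that R(1) by (simp add: m edist_Suc_power2 e_def pyth rad P'k subset_iff)
  qed (rule edist_nonneg)
  have dPP: "edist m x y = edist k x y" if "x \<in> P'" "y \<in> P'" for x y
    using that by (intro edist_eqI edist_nonneg) (simp add: m edist_Suc_power2 P'k)

  define Q where "Q = P' \<union> e ` R"
  have Qdist: "edist m x y \<in> \<int> \<and> edist m x y \<le> ?max" if "x \<in> Q" "y \<in> Q" for x y
  proof -
    have PZ: "edist 2 x y \<in> \<int> \<and> edist 2 x y \<le> ?max" if "x \<in> P" "y \<in> P" for x y
      using that assms(2,3) edist_le_ediam[of P x y 2] by (auto simp: integral_point_set_def)
    have P'Z: "edist k x y \<in> \<int> \<and> edist k x y \<le> ?max" if "x \<in> P'" "y \<in> P'" for x y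
      using that P'(1) assms(11) edist_le_ediam[of P' x y k] by (auto simp: integral_point_set_def)
    \<comment> \<open>The choice \<open>x = q\<close> serves the mixed pairs,
      \<open>x \<in> R\<close> the pairs on the perpendicular line.\<close>
    have RZ: "edist 2 x y \<in> \<int> \<and> edist 2 x y \<le> ?max" if "x \<in> insert q R" "y \<in> R" for x y
      using that R(2) assms(6) by (intro PZ) auto
    from that consider
        "x \<in> P'" "y \<in> P'"
      | y' where "x \<in> P'" "y' \<in> R" "y = e y'"
      | x' where "x' \<in> R" "x = e x'" "y \<in> P'"
      | x' y' where "x' \<in> R" "x = e x'" "y' \<in> R" "y = e y'"
      unfolding Q_def by blast
    then show ?thesis
    proof cases
      case 1
      then show ?thesis using P'Z dPP by metis
    next
      case 2
      then show ?thesis using RZ dPR edist_commute by (metis insertI1)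
    next
      case 3
      then show ?thesis using RZ dPR by (metis insertI1)
    next
      case 4
      then show ?thesis using RZ dRR by (metis insertI2)
    qed
  qed

  \<comment> \<open>The combined set is not contained in a hyperplane\<close>
  have QE: "Q \<subseteq> topspace (Euclidean_space m)"
    using P'E P'(2) by (auto simp: Q_def e_def m mem_Euclidean_space)
  obtain x y where xy: "x \<in> R" "y \<in> R" "x \<noteq> y"
    using integral_point_set_plane_two_others[OF assms(2,6)] unfolding R_def by metis
  have "\<not> (\<exists>H. affine_hyperplane (Suc k) H \<and> Q \<subseteq> H)"
  proof (rule not_in_hyperplane_Suc)
    show "\<not> (\<exists>H. affine_hyperplane k H \<and> P' \<subseteq> H)"
      using P'(1) by (simp add: integral_point_set_def)
    show "c(k := s x) \<in> Q" "c(k := s y) \<in> Q"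
      using xy by (auto simp: Q_def e_def)
    show "s x \<noteq> s y"
      using inj_s xy R(1) by (meson inj_onD subsetD)
  qed (use P'E in \<open>auto simp: Q_def\<close>)
  then have intQ: "integral_point_set m Q"
    using QE Qdist by (auto simp: integral_point_set_def m)

  \<comment> \<open>Counting the points of the combined set\<close>
  have finQ: "finite Q"
    using assms(11) R(3) by (simp add: Q_def)
  have "inj_on e R"
  proof (rule inj_onI)
    fix x y assume "x \<in> R" "y \<in> R" "e x = e y"
    moreover from this have "s x = s y" by (metis e_def fun_upd_same)
    ultimately show "x = y" using inj_s R(1) by (meson inj_onD subsetD)
  qed
  moreover have "P' \<inter> e ` R = {}"
  proof -
    \<comment> \<open>Points on the perpendicular line have horizontal distance 0 from
      \<open>c\<close>, those of \<open>P'\<close> have distance \<open>h > 0\<close>.\<close>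
    have "edist k c (e y) \<noteq> h" for y
      using assms(9) by (simp add: e_def)
    then show ?thesis using rad by blast
  qed
  ultimately have "card Q = n' + (n - 1)"
    using assms(11,12) R(3,4) by (simp add: Q_def card_Un_disjoint card_image)
  \<comment> \<open>Subtraction on naturals is truncated: \<open>n' + (n - 1)\<close> equals
    \<open>n + n' - 1\<close> because \<open>n\<close> is positive.\<close>
  moreover have "n > 0"
    using assms(3,4,6) card_gt_0_iff by blast
  ultimately have cardQ: "card Q = n + n' - 1" by simp
  have "Q \<noteq> {}" using xy by (auto simp: Q_def)
  then have "n + n' - 1 > 0"
    using finQ cardQ card_gt_0_iff by metis
  with intQ finQ cardQ have "min_diam m (n + n' - 1) \<le> ediam m Q"
    by (intro min_diam_attained(2))
  also have "\<dots> \<le> ?max"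
    using finQ \<open>Q \<noteq> {}\<close> Qdist by (intro ediam_leI) auto
  finally show ?thesis by (simp add: k_def)
qed

end
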